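(* Let $(G,b,m)$, $G=(V,\vec E)$, be a finite connected weighted directed graph satisfying the standing assumptions in the context. Let $U=(V_U,\vec E_U)$ be a part of $G$ and let $A=(V_A,\vec E_A)$, $B=(V_B,\vec E_B)$ be two subgraphs of $G$ such that (1) $V=V_A\sqcup V_B=V_{\overset{\circ}{A}}\sqcup V_{\overset{\circ}{B}}\sqcup V_U$ (disjoint unions); (2) $\vec E=\vec E_A\sqcup\vec E_B\sqcup\vec E_U$; (3) $\partial_{\vec E}A=\partial_{\vec E}B=\vec E_U$. Then for all integers $k,l$ with $1\le k,l\le\min(\#V_{\overset{\circ}{A}},\#V_{\overset{\circ}{B}})$, $$\lambda_{k+l}(S_G)\le\max\big(\lambda_k(S^D_{\overset{\circ}{A}}),\ \lambda_l(S^D_{\overset{\circ}{B}})\big).$$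
   Context: Setting. $G=(V,\vec E)$ is a directed graph with $V$ a finite nonempty set and $\vec E\subset V\times V$; $b:V\times V\to[0,\infty)$ satisfies $b(x,x)=0$ for all $x$ and $b(x,y)>0$ iff $(x,y)\in\vec E$; $m:V\to(0,\infty)$. Put $V_x^+=\{y:(x,y)\in\vec E\}$, $V_x^-=\{y:(y,x)\in\vec E\}$, $V_x=V_x^+\cup V_x^-$. Standing assumptions on $G$: (i) connected: any two distinct vertices are joined by a directed path from one of them to the other; (ii) $V_x^+\ne\emptyset$ and $V_x^-\neq\emptyset$ for all $x$; (iii) Assumption $(\beta)$: $\sum_{y\in V_x^+}b(x,y)=\sum_{y\in V_x^-}b(y,x)$ for all $x\in V$. Functions $f:V\to\mathbb C$ carry the inner product $(f,g)_m=\sum_{x}m(x)f(x)\overline{g(x)}$. With $a(x,y)=b(x,y)+b(y,x)$, the special Laplacian is the self-adjoint operator $S_Gf(x)=\frac1{m(x)}\sum_{y\in V_x}a(x,y)(f(x)-f(y))$. For $W\subset V$, the Dirichlet operator $S^D_W$ acts on functions $f$ on $V$ supported in $W$ by $S^D_Wf=(S_Gf)|_W$. Eigenvalues of self-adjoint operators are listed in nondecreasing order with multiplicity. A subgraph $H=(V_H,\vec E_H)$ of $G$ is an induced one: $V_H\subset V$, $\vec E_H=(V_H\times V_H)\cap\vec E$. A part $U=(V_U,\vec E_U)$ of $G$ consists of $V_U\subset V$ and a set of edges $\vec E_U\subset\vec E\cap(V_U\times V_U)$. For a subgraph $A$: the interior is $V_{\overset{\circ}{A}}=\{y\in V_A:V_y\subset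 V_A\}$, and the edge boundary $\partial_{\vec E}A$ is the set of $(x,y)\in\vec E$ with exactly one of $x,y$ in $V_A$. $S^D_{\overset{\circ}{A}}$ means $S^D_W$ with $W=V_{\overset{\circ}{A}}$. *)

theory Defs
  imports "HOL-Analysis.Analysis"
begin

text \<open>
  The vertex set V is the (finite, nonempty) type \<open>'v\<close>; functions from V to the complex numbers are
  vectors of type \<open>complex ^ 'v\<close>, and \<open>*s\<close> is complex scalar multiplication.
\<close>

definition out_nbrs :: "('v \<times> 'v) set \<Rightarrow> 'v \<Rightarrow> 'v set" where
  "out_nbrs E x = {y. (x, y) \<in> E}"

definition in_nbrs :: "('v \<times> 'v) set \<Rightarrow> 'v \<Rightarrow> 'v set" where
  "in_nbrs E x = {y. (y, x) \<in> E}"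

definition nbrs :: "('v \<times> 'v) set \<Rightarrow> 'v \<Rightarrow> 'v set" where
  "nbrs E x = out_nbrs E x \<union> in_nbrs E x"

locale weighted_digraph =
  fixes E :: "('v::finite \<times> 'v) set"
    and b :: "'v \<Rightarrow> 'v \<Rightarrow> real"
    and m :: "'v \<Rightarrow> real"
  assumes b_nonneg: "\<And>x y. 0 \<le> b x y"
    and b_no_loop: "\<And>x. b x x = 0"
    and b_pos_iff: "\<And>x y. 0 < b x y \<longleftrightarrow> (x, y) \<in> E"
    and m_pos: "\<And>x. 0 < m x"
    and connected: "\<And>x y. x \<noteq> y \<Longrightarrow> (x, y) \<in> E\<^sup>+ \<or> (y, x) \<in> E\<^sup>+"
    and out_nonempty: "\<And>x. out_nbrs E x \<noteq> {}"
    and in_nonempty: "\<And>x. in_nbrs E x \<noteq> {}"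
    and beta: "\<And>x. (\<Sum>y\<in>out_nbrs E x. b x y) = (\<Sum>y\<in>in_nbrs E x. b y x)"

definition is_subgraph :: "('v \<times> 'v) set \<Rightarrow> 'v set \<Rightarrow> ('v \<times> 'v) set \<Rightarrow> bool" where
  "is_subgraph E VH EH \<longleftrightarrow> EH = (VH \<times> VH) \<inter> E"

definition is_part :: "('v \<times> 'v) set \<Rightarrow> 'v set \<Rightarrow> ('v \<times> 'v) set \<Rightarrow> bool" where
  "is_part E VU EU \<longleftrightarrow> EU \<subseteq> E \<inter> (VU \<times> VU)"

definition vertex_interior :: "('v \<times> 'v) set \<Rightarrow> 'v set \<Rightarrow> 'v set" where
  "vertex_interior E VA = {y \<in> VA. nbrs E y \<subseteq> VA}"

definition edge_boundary :: "('v \<times> 'v) set \<Rightarrow> 'v set \<Rightarrow> ('v \<times> 'v) set" where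
  "edge_boundary E VA = {(x, y) \<in> E. (x \<in> VA) \<noteq> (y \<in> VA)}"

definition inner_m :: "('v::finite \<Rightarrow> real) \<Rightarrow> complex ^ 'v \<Rightarrow> complex ^ 'v \<Rightarrow> complex" where
  "inner_m m f g = (\<Sum>x\<in>UNIV. complex_of_real (m x) * f $ x * cnj (g $ x))"

definition sym_weight :: "('v \<Rightarrow> 'v \<Rightarrow> real) \<Rightarrow> 'v \<Rightarrow> 'v \<Rightarrow> real" where
  "sym_weight b x y = b x y + b y x"

definition special_laplacian ::
  "('v::finite \<times> 'v) set \<Rightarrow> ('v \<Rightarrow> 'v \<Rightarrow> real) \<Rightarrow> ('v \<Rightarrow> real) \<Rightarrow> complex ^ 'v \<Rightarrow> complex ^ 'v" where
  "special_laplacian E b m f =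
     (\<chi> x. 1 / complex_of_real (m x) *
           (\<Sum>y\<in>nbrs E x. complex_of_real (sym_weight b x y) * (f $ x - f $ y)))"

definition supported_in :: "'v::finite set \<Rightarrow> (complex ^ 'v) set" where
  "supported_in W = {f. \<forall>x. x \<notin> W \<longrightarrow> f $ x = 0}"

text \<open>
  The Dirichlet operator is only ever considered on \<open>supported_in W\<close>; the restriction to W is
  extended by 0, so that the result lies in \<open>supported_in W\<close> again.
\<close>

definition dirichlet_laplacian ::
  "('v::finite \<times> 'v) set \<Rightarrow> ('v \<Rightarrow> 'v \<Rightarrow> real) \<Rightarrow> ('v \<Rightarrow> real) \<Rightarrow> 'v set
     \<Rightarrow> complex ^ 'v \<Rightarrow> complex ^ 'v" where
  "dirichlet_laplacian E b m W f = (\<chi> x. if x \<in> W then special_laplacian E b m f $ x else 0)"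

text \<open>
  Below, \<open>L\<close> is the complex subspace on which the operator \<open>T\<close> acts. Only real eigenvalues are
  listed: for the self-adjoint operators at hand there are no others, see
  \<open>eigenvalue_special_real\<close> and \<open>eigenvalue_dirichlet_real\<close>. The multiplicity is the complex
  dimension of the eigenspace, and positions in the list are counted from 1.
\<close>

definition eigenspace ::
  "(complex ^ 'v) set \<Rightarrow> (complex ^ 'v \<Rightarrow> complex ^ 'v) \<Rightarrow> complex \<Rightarrow> (complex ^ 'v::finite) set" where
  "eigenspace L T \<mu> = {f \<in> L. T f = \<mu> *s f}"

definition is_eigenvalue ::
  "(complex ^ 'v::finite) set \<Rightarrow> (complex ^ 'v \<Rightarrow> complex ^ 'v) \<Rightarrow> complex \<Rightarrow> bool" where
  "is_eigenvalue L T \<mu> \<longleftrightarrow> (\<exists>f\<in>L. f \<noteq> 0 \<and> T f = \<mu> *s f)"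

definition eigenvalue_list ::
  "(complex ^ 'v::finite) set \<Rightarrow> (complex ^ 'v \<Rightarrow> complex ^ 'v) \<Rightarrow> real list" where
  "eigenvalue_list L T =
     concat (map (\<lambda>\<mu>. replicate (vec.dim (eigenspace L T (complex_of_real \<mu>))) \<mu>)
       (sorted_list_of_set {\<mu>. is_eigenvalue L T (complex_of_real \<mu>)}))"

definition nth_eigenvalue ::
  "(complex ^ 'v::finite) set \<Rightarrow> (complex ^ 'v \<Rightarrow> complex ^ 'v) \<Rightarrow> nat \<Rightarrow> real" where
  "nth_eigenvalue L T k = eigenvalue_list L T ! (k - 1)"

definition lambda_special ::
  "('v::finite \<times> 'v) set \<Rightarrow> ('v \<Rightarrow> 'v \<Rightarrow> real) \<Rightarrow> ('v \<Rightarrow> real) \<Rightarrow> nat \<Rightarrow> real" where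
  "lambda_special E b m k = nth_eigenvalue UNIV (special_laplacian E b m) k"

definition lambda_dirichlet ::
  "('v::finite \<times> 'v) set \<Rightarrow> ('v \<Rightarrow> 'v \<Rightarrow> real) \<Rightarrow> ('v \<Rightarrow> real) \<Rightarrow> 'v set \<Rightarrow> nat \<Rightarrow> real" where
  "lambda_dirichlet E b m W k = nth_eigenvalue (supported_in W) (dirichlet_laplacian E b m W) k"

context weighted_digraph
begin

lemma special_laplacian_self_adjoint:
  "inner_m m (special_laplacian E b m f) g = inner_m m f (special_laplacian E b m g)"
proof -
  let ?a = "\<lambda>x y. complex_of_real (sym_weight b x y)"
  have a0: "?a x y = 0" if "y \<notin> nbrs E x" for x y
  proof -
    have "\<not> 0 < b x y" "\<not> 0 < b y x"
      using that by (auto simp: b_pos_iff nbrs_def out_nbrs_def in_nbrs_def)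
    then show ?thesis
      using b_nonneg[of x y] b_nonneg[of y x] by (simp add: sym_weight_def)
  qed
  have full: "(\<Sum>y\<in>nbrs E x. ?a x y * (h $ x - h $ y)) = (\<Sum>y\<in>UNIV. ?a x y * (h $ x - h $ y))"
    for x and h :: "complex ^ 'v"
    by (rule sum.mono_neutral_left) (use a0 in auto)
  have m0: "complex_of_real (m x) \<noteq> 0" for x
    using m_pos[of x] by simp
  have asym: "?a x y = ?a y x" for x y
    by (simp add: sym_weight_def)
  have swap: "(\<Sum>x\<in>UNIV. \<Sum>y\<in>UNIV. ?a x y * (f $ y * cnj (g $ x)))
      = (\<Sum>x\<in>UNIV. \<Sum>y\<in>UNIV. ?a x y * (f $ x * cnj (g $ y)))"
    by (subst sum.swap) (simp only: asym)
  have "inner_m m (special_laplacian E b m f) g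
      = (\<Sum>x\<in>UNIV. \<Sum>y\<in>UNIV. ?a x y * (f $ x * cnj (g $ x)) - ?a x y * (f $ y * cnj (g $ x)))"
    unfolding inner_m_def special_laplacian_def full
    using m0 by (simp add: sum_distrib_left sum_distrib_right algebra_simps)
  also have "\<dots> = (\<Sum>x\<in>UNIV. \<Sum>y\<in>UNIV. ?a x y * (f $ x * cnj (g $ x)) - ?a x y * (f $ x * cnj (g $ y)))"
    by (simp add: sum_subtractf swap)
  also have "\<dots> = inner_m m f (special_laplacian E b m g)"
    unfolding inner_m_def special_laplacian_def full
    using m0 by (simp add: sum_distrib_left algebra_simps)
  finally show ?thesis .
qed

lemma dirichlet_laplacian_self_adjoint:
  assumes "f \<in> supported_in W" "g \<in> supported_in W"
  shows "inner_m m (dirichlet_laplacian E b m W f) g = inner_m m f (dirichlet_laplacian E b m W g)"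
proof -
  have "inner_m m (dirichlet_laplacian E b m W f) g = inner_m m (special_laplacian E b m f) g"
    unfolding inner_m_def dirichlet_laplacian_def
    by (rule sum.cong) (use assms in \<open>auto simp: supported_in_def\<close>)
  also have "\<dots> = inner_m m f (special_laplacian E b m g)"
    by (rule special_laplacian_self_adjoint)
  also have "\<dots> = inner_m m f (dirichlet_laplacian E b m W g)"
    unfolding inner_m_def dirichlet_laplacian_def
    by (rule sum.cong) (use assms in \<open>auto simp: supported_in_def\<close>)
  finally show ?thesis .
qed

lemma inner_m_self_nonzero:
  assumes "f \<noteq> 0"
  shows "inner_m m f f \<noteq> 0"
proof -
  obtain x where x: "f $ x \<noteq> 0"
    using assms by (auto simp: vec_eq_iff)
  have "inner_m m f f = complex_of_real (\<Sum>x\<in>UNIV. m x * (cmod (f $ x))\<^sup>2)"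
    by (simp add: inner_m_def complex_norm_square mult.assoc del: of_real_power)
  moreover have "0 < (\<Sum>x\<in>UNIV. m x * (cmod (f $ x))\<^sup>2)"
    by (rule sum_pos2[of _ x]) (use x m_pos in \<open>auto simp: less_imp_le\<close>)
  ultimately show ?thesis
    by (metis less_irrefl of_real_eq_0_iff)
qed

lemma eigenvalue_self_adjoint_real:
  assumes "\<And>f. f \<in> L \<Longrightarrow> inner_m m (T f) f = inner_m m f (T f)" "is_eigenvalue L T \<mu>"
  shows "\<mu> \<in> \<real>"
proof -
  obtain f where f: "f \<in> L" "f \<noteq> 0" "T f = \<mu> *s f"
    using assms(2) by (auto simp: is_eigenvalue_def)
  have "\<mu> * inner_m m f f = inner_m m (T f) f"
    by (simp add: inner_m_def f sum_distrib_left mult_ac)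
  also have "\<dots> = cnj \<mu> * inner_m m f f"
    by (subst assms(1)[OF f(1)]) (simp add: inner_m_def f sum_distrib_left mult_ac)
  finally have "\<mu> = cnj \<mu>"
    using inner_m_self_nonzero[OF f(2)] by simp
  then show ?thesis
    by (metis Reals_cnj_iff)
qed

lemma eigenvalue_special_real:
  "is_eigenvalue UNIV (special_laplacian E b m) \<mu> \<Longrightarrow> \<mu> \<in> \<real>"
  by (rule eigenvalue_self_adjoint_real) (auto intro: special_laplacian_self_adjoint)

lemma eigenvalue_dirichlet_real:
  "is_eigenvalue (supported_in W) (dirichlet_laplacian E b m W) \<mu> \<Longrightarrow> \<mu> \<in> \<real>"
  by (rule eigenvalue_self_adjoint_real) (auto intro: dirichlet_laplacian_self_adjoint)

end

end

theory Submission
  imports Defs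
begin

text \<open>
  If \<open>f\<close> is supported in the interior of \<open>A\<close>, then \<open>S f\<close> is supported in \<open>A\<close>, so \<open>(S f, g) = 0\<close> for
  every \<open>g\<close> supported in the interior of \<open>B\<close>, and the Rayleigh quotient of \<open>S\<close> at \<open>f + g\<close> is a weighted
  mean of the two Dirichlet quotients. The first \<open>k\<close> and the first \<open>l\<close> Dirichlet eigenfunctions thus
  span a space of dimension \<open>k + l\<close> on which the quotient is at most the maximum of the two
  eigenvalues, and the min-max principle gives the claim. The spectral theorem behind the min-max
  principle comes from minimising the Rayleigh quotient on the unit sphere of an invariant subspace.
\<close>

section \<open>The weighted inner product\<close>

lemma inner_m_add_left: "inner_m m (f + g) h = inner_m m f h + inner_m m g h"
  by (simp add: inner_m_def algebra_simps sum.distrib)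

lemma inner_m_add_right: "inner_m m h (f + g) = inner_m m h f + inner_m m h g"
  by (simp add: inner_m_def algebra_simps sum.distrib)

lemma inner_m_diff_left: "inner_m m (f - g) h = inner_m m f h - inner_m m g h"
  by (simp add: inner_m_def algebra_simps sum_subtractf)

lemma inner_m_scale_left: "inner_m m (c *s f) h = c * inner_m m f h"
  by (simp add: inner_m_def sum_distrib_left mult_ac)

lemma inner_m_scale_right: "inner_m m h (c *s f) = cnj c * inner_m m h f"
  by (simp add: inner_m_def sum_distrib_left mult_ac)

lemma inner_m_zero_left [simp]: "inner_m m 0 h = 0"
  by (simp add: inner_m_def)

lemma inner_m_zero_right [simp]: "inner_m m h 0 = 0"
  by (simp add: inner_m_def)

lemma inner_m_sum_left: "inner_m m (\<Sum>i\<in>I. f i) h = (\<Sum>i\<in>I. inner_m m (f i) h)"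
  by (induction I rule: infinite_finite_induct) (auto simp: inner_m_add_left)

lemma inner_m_sum_right: "inner_m m h (\<Sum>i\<in>I. f i) = (\<Sum>i\<in>I. inner_m m h (f i))"
  by (induction I rule: infinite_finite_induct) (auto simp: inner_m_add_right)

lemma cnj_inner_m: "cnj (inner_m m f g) = inner_m m g f"
  by (simp add: inner_m_def mult_ac)

lemma inner_m_disjoint_support:
  assumes "f \<in> supported_in V" "g \<in> supported_in W" "V \<inter> W = {}"
  shows "inner_m m f g = 0"
  unfolding inner_m_def by (rule sum.neutral) (use assms in \<open>auto simp: supported_in_def\<close>)

lemma continuous_on_inner_m [continuous_intros]:
  assumes "continuous_on S f" "continuous_on S g"
  shows "continuous_on S (\<lambda>x. inner_m m (f x) (g x))"
  unfolding inner_m_def by (intro continuous_intros assms)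

text \<open>The Parseval formula for an orthogonal set that need not be normalised, so the squared
  lengths stay as weights. It gives both the independence of orthogonal sets and the diagonal form
  of Rayleigh quotients.\<close>

lemma inner_m_orthogonal_expansion:
  assumes "finite C" "pairwise (\<lambda>e e'. inner_m m e e' = 0) C"
  shows "inner_m m (\<Sum>e\<in>C. a e *s e) (\<Sum>e\<in>C. c e *s e)
    = (\<Sum>e\<in>C. a e * cnj (c e) * inner_m m e e)"
proof -
  have "(\<Sum>e'\<in>C. a e' * cnj (c e) * inner_m m e' e) = a e * cnj (c e) * inner_m m e e"
    if "e \<in> C" for e
  proof -
    have "(\<Sum>e'\<in>C. a e' * cnj (c e) * inner_m m e' e)
        = (\<Sum>e'\<in>{e}. a e' * cnj (c e) * inner_m m e' e)"
      by (rule sum.mono_neutral_right) (use that assms in \<open>auto simp: pairwise_def\<close>)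
    then show ?thesis by simp
  qed
  then show ?thesis
    by (auto simp: inner_m_sum_left inner_m_sum_right inner_m_scale_left inner_m_scale_right
        sum_distrib_left mult_ac intro!: sum.cong)
qed

locale weighted_inner =
  fixes m :: "'v::finite \<Rightarrow> real"
  assumes m_pos: "\<And>x. 0 < m x"
begin

lemma inner_m_self_pos:
  assumes "f \<noteq> 0"
  shows "0 < Re (inner_m m f f)"
proof -
  obtain x where x: "f $ x \<noteq> 0"
    using assms by (auto simp: vec_eq_iff)
  have "inner_m m f f = complex_of_real (\<Sum>x\<in>UNIV. m x * (cmod (f $ x))\<^sup>2)"
    by (simp add: inner_m_def complex_norm_square mult.assoc del: of_real_power)
  moreover have "0 < (\<Sum>x\<in>UNIV. m x * (cmod (f $ x))\<^sup>2)"
    by (rule sum_pos2[of _ x]) (use x m_pos in \<open>auto simp: less_imp_le\<close>)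
  ultimately show ?thesis by simp
qed

lemma inner_m_self_nonneg: "0 \<le> Re (inner_m m f f)"
  by (cases "f = 0") (auto dest: inner_m_self_pos)

lemma inner_m_self_eq_0_iff: "inner_m m f f = 0 \<longleftrightarrow> f = 0"
  using inner_m_self_pos[of f] by (cases "f = 0") auto

lemma orthogonal_independent:
  assumes "finite C" "0 \<notin> C" "pairwise (\<lambda>e e'. inner_m m e e' = 0) C"
  shows "vec.independent C"
proof (rule vec.independent_if_scalars_zero[OF assms(1)])
  fix u :: "complex ^ 'v \<Rightarrow> complex" and e
  assume u: "(\<Sum>x\<in>C. u x *s x) = 0" and e: "e \<in> C"
  \<comment> \<open>The vector \<open>e\<close> is rewritten as a combination over \<open>C\<close>
    with indicator coefficients, so that the expansion formula, which has the same index set in both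
    slots, isolates \<open>u e\<close>.\<close>
  have "(\<Sum>x\<in>C. (if x = e then 1 else 0) *s x) = (\<Sum>x\<in>C. if x = e then x else 0)"
    by (rule sum.cong) auto
  then have single: "e = (\<Sum>x\<in>C. (if x = e then 1 else 0) *s x)"
    using e assms(1) by simp
  have "inner_m m (\<Sum>x\<in>C. u x *s x) (\<Sum>x\<in>C. (if x = e then 1 else 0) *s x)
      = (\<Sum>x\<in>C. u x * cnj (if x = e then 1 else 0) * inner_m m x x)"
    by (rule inner_m_orthogonal_expansion[OF assms(1,3)])
  also have "\<dots> = (\<Sum>x\<in>C. if x = e then u x * inner_m m x x else 0)"
    by (rule sum.cong) auto
  finally have "u e * inner_m m e e = 0"
    using u e assms(1) by simp
  then show "u e = 0"
    using inner_m_self_eq_0_iff e assms(2) by auto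
qed

end

section \<open>The spectral theorem\<close>

text \<open>Bridge between the complex structure and the real one: compactness and continuity facts
  are stated for real vector spaces.\<close>

lemma scaleR_vec_complex: "r *\<^sub>R f = complex_of_real r *s (f :: complex ^ 'v::finite)"
  by (simp add: vec_eq_iff scaleR_conv_of_real[symmetric])

text \<open>Linearity is asked on the whole space, invariance and symmetry only on \<open>L\<close>.
  Thus \<open>L\<close> can shrink to an orthogonal complement while \<open>T\<close> stays the same
  function.\<close>

locale self_adjoint_operator = weighted_inner m
  for m :: "'v::finite \<Rightarrow> real" +
  fixes L :: "(complex ^ 'v) set" and T :: "complex ^ 'v \<Rightarrow> complex ^ 'v"
  assumes subspace: "vec.subspace L"
    and linear: "Vector_Spaces.linear (*s) (*s) T"
    and maps: "\<And>f. f \<in> L \<Longrightarrow> T f \<in> L"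
    and self_adjoint: "\<And>f g. f \<in> L \<Longrightarrow> g \<in> L \<Longrightarrow> inner_m m (T f) g = inner_m m f (T g)"
begin

text \<open>A minimiser \<open>e\<close> of the Rayleigh quotient, with minimum \<open>t\<close>, is
  an eigenvector: the form of \<open>D = T - t\<close> is nonnegative on \<open>L\<close> and
  vanishes at \<open>e\<close>, and perturbing \<open>e\<close> along \<open>D e\<close> would make
  it negative unless \<open>D e = 0\<close>.\<close>

lemma exists_eigenvector:
  assumes "L \<noteq> {0}"
  obtains t e where "e \<in> L" "e \<noteq> 0" "T e = complex_of_real t *s e"
proof -
  interpret T: Vector_Spaces.linear "(*s)" "(*s)" T by (rule linear)
  let ?Q = "\<lambda>f. Re (inner_m m (T f) f)" and ?N = "\<lambda>f. Re (inner_m m f f)"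
  have "Real_Vector_Spaces.linear T"
    by (rule linearI) (simp_all add: T.add T.scale scaleR_vec_complex)
  then have cont_T: "continuous_on A T" for A
    by (simp add: linear_continuous_on linear_conv_bounded_linear)
  \<comment> \<open>The sphere is that of the Euclidean norm, where compactness is at hand, while
    the quotient uses the weight \<open>m\<close>. This is harmless because the quotient is
    invariant under scaling.\<close>
  have "Real_Vector_Spaces.subspace L"
    using subspace by (simp add: vec.subspace_def real_vector.subspace_def scaleR_vec_complex)
  then have "compact (L \<inter> sphere 0 1)"
    by (intro closed_Int_compact closed_subspace) auto
  moreover have normalized: "(1 / norm f) *\<^sub>R f \<in> L \<inter> sphere 0 1" if "f \<in> L" "f \<noteq> 0" for f
  proof
    show "(1 / norm f) *\<^sub>R f \<in> L"
      unfolding scaleR_vec_complex by (rule vec.subspace_scale[OF subspace that(1)])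
    show "(1 / norm f) *\<^sub>R f \<in> sphere 0 1" using that(2) by simp
  qed
  then have "L \<inter> sphere 0 1 \<noteq> {}"
    using assms vec.subspace_0[OF subspace] by blast
  moreover have "continuous_on (L \<inter> sphere 0 1) (\<lambda>f. ?Q f / ?N f)"
  proof (intro continuous_intros cont_T ballI)
    fix f assume "f \<in> L \<inter> sphere 0 1"
    then have "f \<noteq> 0" by auto
    then show "?N f \<noteq> 0" using inner_m_self_pos by force
  qed
  ultimately obtain e where e: "e \<in> L \<inter> sphere 0 1"
    and min: "\<And>f. f \<in> L \<inter> sphere 0 1 \<Longrightarrow> ?Q e / ?N e \<le> ?Q f / ?N f"
    using continuous_attains_inf[of "L \<inter> sphere 0 1" "\<lambda>f. ?Q f / ?N f"] by blast
  define t where "t = ?Q e / ?N e"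
  have e0: "e \<noteq> 0" and eL: "e \<in> L" using e by auto
  define D where "D f = T f - complex_of_real t *s f" for f
  have D_add: "D (f + g) = D f + D g" and D_scale: "D (c *s f) = c *s D f" for f g c
    by (simp_all add: D_def T.add T.scale vec_eq_iff algebra_simps)
  have D_L: "D f \<in> L" if "f \<in> L" for f
    unfolding D_def by (intro vec.subspace_diff vec.subspace_scale subspace maps that)
  have D_sym: "inner_m m (D f) g = inner_m m f (D g)" if "f \<in> L" "g \<in> L" for f g
  proof -
    have "inner_m m f (D g) = cnj (inner_m m (D g) f)" by (simp add: cnj_inner_m)
    then show ?thesis
      by (simp add: D_def inner_m_diff_left inner_m_scale_left cnj_inner_m self_adjoint that)
  qed
  have ReD: "Re (inner_m m (D f) f) = ?Q f - t * ?N f" for f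
    by (simp add: D_def inner_m_diff_left inner_m_scale_left)
  have D_nonneg: "0 \<le> Re (inner_m m (D f) f)" if f: "f \<in> L" for f
  proof (cases "f = 0")
    case False
    define c where "c = 1 / norm f"
    have c: "c > 0" using False by (simp add: c_def)
    have "t \<le> ?Q (c *\<^sub>R f) / ?N (c *\<^sub>R f)"
      unfolding t_def c_def by (rule min[OF normalized[OF f False]])
    also have "\<dots> = (c * c * ?Q f) / (c * c * ?N f)"
      by (simp add: scaleR_vec_complex T.scale inner_m_scale_left inner_m_scale_right mult.assoc)
    also have "\<dots> = ?Q f / ?N f" using c by simp
    finally show ?thesis
      using inner_m_self_pos[OF False] by (simp add: ReD field_simps)
  qed (simp add: inner_m_def)
  have D_e: "Re (inner_m m (D e) e) = 0"
    using inner_m_self_pos[OF e0] by (simp add: ReD t_def)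
  define g where "g = D e"
  have gL: "g \<in> L" by (simp add: g_def D_L eL)
  define p where "p = Re (inner_m m g g)"
  define q where "q = Re (inner_m m (D g) g)"
  \<comment> \<open>The form of \<open>D\<close> at \<open>e + s g\<close> as a polynomial in
    \<open>s\<close>: the constant term vanishes, and both mixed terms equal \<open>s p\<close>,
    since (D g, e) = (g, D e) = (g, g).\<close>
  have quad: "0 \<le> 2 * s * p + s\<^sup>2 * q" for s :: real
  proof -
    let ?s = "complex_of_real s"
    have Dge: "inner_m m (D g) e = inner_m m g g"
      using D_sym[OF gL eL] by (simp add: g_def)
    have "0 \<le> Re (inner_m m (D (e + ?s *s g)) (e + ?s *s g))"
      by (intro D_nonneg vec.subspace_add vec.subspace_scale subspace eL gL)
    also have "inner_m m (D (e + ?s *s g)) (e + ?s *s g)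
        = inner_m m (D e) e + 2 * ?s * inner_m m g g + ?s * ?s * inner_m m (D g) g"
      by (simp add: D_add D_scale inner_m_add_left inner_m_add_right inner_m_scale_left
          inner_m_scale_right Dge g_def[symmetric] algebra_simps)
    also have "Re \<dots> = 2 * s * p + s\<^sup>2 * q"
      using D_e by (simp add: p_def q_def power2_eq_square)
    finally show ?thesis .
  qed
  have "g = 0"
  proof (rule ccontr)
    assume "g \<noteq> 0"
    then have p: "p > 0" unfolding p_def by (rule inner_m_self_pos)
    show False
    \<comment> \<open>For \<open>q\<close> at most 0, the value at \<open>s = -1\<close> is
      \<open>q - 2 p\<close>, which is negative. Otherwise \<open>s = - p / q\<close> is the vertex
      of the parabola, where the value is \<open>- p^2 / q\<close>.\<close>
    proof (cases "q \<le> 0")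
      case True
      then show False using quad[of "-1"] p by simp
    next
      case False
      then have "2 * (- p / q) * p + (- p / q)\<^sup>2 * q = - (p\<^sup>2 / q)"
        by (simp add: field_simps power2_eq_square)
      moreover have "p\<^sup>2 / q > 0" using p False by simp
      ultimately show False using quad[of "- p / q"] by linarith
    qed
  qed
  then have "T e = complex_of_real t *s e" by (simp add: g_def D_def)
  then show thesis using that eL e0 by blast
qed

end

text \<open>The basis is orthogonal but not normalised; its independence follows from orthogonality
  and \<open>0 \<notin> B\<close>. A multiple eigenvalue appears as a value of \<open>ev\<close> at
  several vectors.\<close>

definition eigenbasis :: "('v::finite \<Rightarrow> real) \<Rightarrow> (complex ^ 'v) set
    \<Rightarrow> (complex ^ 'v \<Rightarrow> complex ^ 'v) \<Rightarrow> (complex ^ 'v) set \<Rightarrow> (complex ^ 'v \<Rightarrow> real) \<Rightarrow> bool" where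
  "eigenbasis m L T B ev \<longleftrightarrow> finite B \<and> 0 \<notin> B \<and> pairwise (\<lambda>e e'. inner_m m e e' = 0) B
     \<and> vec.span B = L \<and> (\<forall>e\<in>B. T e = complex_of_real (ev e) *s e)"

text \<open>Induction on the dimension: an eigenvector \<open>e\<close> is split off, and its
  orthogonal complement \<open>L'\<close> in \<open>L\<close> is invariant because (T f, e) = (f, T
  e) = t (f, e) = 0 there.\<close>

theorem spectral_theorem:
  assumes "self_adjoint_operator m L T"
  obtains B ev where "eigenbasis m L T B ev"
proof -
  have "\<exists>B ev. eigenbasis m L T B ev"
    using assms
  proof (induction "vec.dim L" arbitrary: L rule: less_induct)
    case less
    interpret self_adjoint_operator m L T by (rule less.prems)
    show ?case
    proof (cases "L = {0}")
      case True
      then have "eigenbasis m L T {} (\<lambda>_. 0)" by (simp add: eigenbasis_def)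
      then show ?thesis by blast
    next
      case False
      obtain t e where e: "e \<in> L" "e \<noteq> 0" and Te: "T e = complex_of_real t *s e"
        using exists_eigenvector[OF False] by blast
      define L' where "L' = {f \<in> L. inner_m m f e = 0}"
      have sub': "vec.subspace L'"
        using subspace by (auto simp: L'_def vec.subspace_def inner_m_add_left inner_m_scale_left)
      have "e \<notin> L'" using e inner_m_self_eq_0_iff by (simp add: L'_def)
      then have "L' \<subset> L" using e by (auto simp: L'_def)
      then have "vec.dim L' < vec.dim L"
        using sub' subspace by (intro vec.dim_psubset) (simp add: vec.span_eq_iff[THEN iffD2])
      moreover have "self_adjoint_operator m L' T"
      proof (intro self_adjoint_operator.intro weighted_inner_axioms
          self_adjoint_operator_axioms.intro sub' linear)
        show "T f \<in> L'" if "f \<in> L'" for f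
          using that e by (simp add: L'_def maps self_adjoint Te inner_m_scale_right)
      qed (auto simp: self_adjoint L'_def)
      ultimately obtain B ev where B: "eigenbasis m L' T B ev"
        using less.hyps by blast
      have span: "vec.span B = L'" using B by (simp add: eigenbasis_def)
      then have BL: "B \<subseteq> L'" using vec.span_superset by blast
      have orth: "inner_m m f e = 0 \<and> inner_m m e f = 0" if "f \<in> B" for f
        using BL that cnj_inner_m[of m f e] by (auto simp: L'_def)
      have "vec.span (insert e B) = L"
      proof
        show "vec.span (insert e B) \<subseteq> L"
          using BL e subspace by (intro vec.span_minimal) (auto simp: L'_def)
        show "L \<subseteq> vec.span (insert e B)"
        proof
          fix f assume f: "f \<in> L"
          \<comment> \<open>The coefficient of the orthogonal projection of \<open>f\<close> onto
            the line of \<open>e\<close>.\<close>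
          define c where "c = inner_m m f e / inner_m m e e"
          have "inner_m m (f - c *s e) e = 0"
            using e inner_m_self_eq_0_iff
            by (simp add: c_def inner_m_diff_left inner_m_scale_left)
          then have "f - c *s e \<in> L'"
            using f e subspace by (simp add: L'_def vec.subspace_diff vec.subspace_scale)
          then show "f \<in> vec.span (insert e B)"
            using span vec.span_breakdown_eq by blast
        qed
      qed
      moreover have "pairwise (\<lambda>e e'. inner_m m e e' = 0) (insert e B)"
        using B orth by (auto simp: eigenbasis_def pairwise_insert)
      ultimately have "eigenbasis m L T (insert e B) (ev(e := t))"
        using B e Te \<open>e \<notin> L'\<close> BL by (auto simp: eigenbasis_def)
      then show ?thesis by blast
    qed
  qed
  then show thesis using that by blast
qed

section \<open>The list of eigenvalues\<close>

text \<open>If \<open>f\<close> has coefficients \<open>c e\<close>, then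
  \<open>T f - \<mu> f\<close> has coefficients \<open>(ev e - \<mu>) * c e\<close>. Independence
  makes these vanish, so only vectors with \<open>ev e = \<mu>\<close> contribute to
  \<open>f\<close>.\<close>

lemma eigenspace_eq_span:
  assumes "weighted_inner m" "Vector_Spaces.linear (*s) (*s) T" "eigenbasis m L T B ev"
  shows "eigenspace L T (complex_of_real \<mu>) = vec.span {e \<in> B. ev e = \<mu>}"
proof
  interpret weighted_inner m by (rule assms(1))
  interpret T: Vector_Spaces.linear "(*s)" "(*s)" T by (rule assms(2))
  have fin: "finite B" and "0 \<notin> B" "pairwise (\<lambda>e e'. inner_m m e e' = 0) B"
    and span: "vec.span B = L" and ev: "\<And>e. e \<in> B \<Longrightarrow> T e = complex_of_real (ev e) *s e"
    using assms(3) by (auto simp: eigenbasis_def)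
  then have indep: "vec.independent B" by (intro orthogonal_independent)
  show "eigenspace L T (complex_of_real \<mu>) \<subseteq> vec.span {e \<in> B. ev e = \<mu>}"
  proof
    fix f assume f: "f \<in> eigenspace L T (complex_of_real \<mu>)"
    then have "f \<in> vec.span B" by (simp add: eigenspace_def span)
    then obtain c where c: "f = (\<Sum>e\<in>B. c e *s e)"
      using vec.span_finite[OF fin] by auto
    have "T f = (\<Sum>e\<in>B. c e *s (complex_of_real (ev e) *s e))"
      by (simp add: c T.sum T.scale ev cong: sum.cong)
    moreover have "complex_of_real \<mu> *s f = (\<Sum>e\<in>B. complex_of_real \<mu> *s (c e *s e))"
      unfolding c by (rule vec.scale_sum_right)
    ultimately have "T f - complex_of_real \<mu> *s f
        = (\<Sum>e\<in>B. c e *s (complex_of_real (ev e) *s e) - complex_of_real \<mu> *s (c e *s e))"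
      by (simp only: sum_subtractf)
    also have "\<dots> = (\<Sum>e\<in>B. ((complex_of_real (ev e) - complex_of_real \<mu>) * c e) *s e)"
      by (intro sum.cong) (simp_all add: vec_eq_iff algebra_simps)
    finally have "(\<Sum>e\<in>B. ((complex_of_real (ev e) - complex_of_real \<mu>) * c e) *s e)
        = T f - complex_of_real \<mu> *s f" ..
    also have "\<dots> = 0" using f by (simp add: eigenspace_def)
    finally have zero: "(\<Sum>e\<in>B. ((complex_of_real (ev e) - complex_of_real \<mu>) * c e) *s e) = 0" .
    have "c e = 0" if "e \<in> B" "ev e \<noteq> \<mu>" for e
    proof -
      have "(complex_of_real (ev e) - complex_of_real \<mu>) * c e = 0"
        by (rule vec.independentD[OF indep fin subset_refl zero that(1)])
      then show ?thesis using that(2) by simp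
    qed
    then have eq: "f = (\<Sum>e\<in>{e \<in> B. ev e = \<mu>}. c e *s e)"
      unfolding c by (intro sum.mono_neutral_right) (use fin in auto)
    show "f \<in> vec.span {e \<in> B. ev e = \<mu>}"
      unfolding eq by (intro vec.span_sum vec.span_scale vec.span_base)
  qed
  have "vec.subspace L" using span by (metis vec.subspace_span)
  then have "vec.subspace (eigenspace L T (complex_of_real \<mu>))"
    by (auto simp: vec.subspace_def eigenspace_def T.add T.scale T.zero
        vec.scale_right_distrib mult_ac)
  then show "vec.span {e \<in> B. ev e = \<mu>} \<subseteq> eigenspace L T (complex_of_real \<mu>)"
    by (rule vec.span_minimal[rotated])
       (use span ev in \<open>auto simp: eigenspace_def intro: vec.span_base\<close>)
qed

lemma count_concat_replicate:
  assumes "distinct xs"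
  shows "count (mset (concat (map (\<lambda>x. replicate (n x) x) xs))) y = (if y \<in> set xs then n y else 0)"
  using assms by (induction xs) auto

lemma sorted_concat_replicate:
  assumes "sorted xs"
  shows "sorted (concat (map (\<lambda>x. replicate (n x) x) xs))"
  using assms by (induction xs) (auto simp: sorted_append)

text \<open>The entries at most \<open>t\<close> form a prefix of a sorted list, so a bound on one
  entry becomes a count. Positions start at 0, hence the strict inequality.\<close>

lemma sorted_nth_le_iff:
  fixes xs :: "'a::linorder list"
  assumes "sorted xs" "i < length xs"
  shows "xs ! i \<le> t \<longleftrightarrow> i < length (filter (\<lambda>x. x \<le> t) xs)"
  using assms
proof (induction xs arbitrary: i)
  case (Cons x xs)
  show ?case
  proof (cases "x \<le> t")
    case True
    then show ?thesis using Cons by (cases i) auto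
  next
    case False
    then have "\<forall>y\<in>set (x # xs). \<not> y \<le> t" using Cons.prems(1) by auto
    then have "filter (\<lambda>x. x \<le> t) (x # xs) = []" by (simp only: filter_empty_conv)
    moreover have "\<not> (x # xs) ! i \<le> t"
      using \<open>\<forall>y\<in>set (x # xs). \<not> y \<le> t\<close> nth_mem[OF Cons.prems(2)] by blast
    ultimately show ?thesis by (simp only: list.size) simp
  qed
qed simp

lemma sorted_eigenvalue_list: "sorted (eigenvalue_list L T)"
  unfolding eigenvalue_list_def by (rule sorted_concat_replicate) simp

text \<open>Ties the list, built from eigenspace dimensions, to an arbitrary eigenbasis: on both
  sides the multiplicity of \<open>\<mu>\<close> is the number of basis vectors with value
  \<open>\<mu>\<close>.\<close>

lemma mset_eigenvalue_list:
  assumes "weighted_inner m" "Vector_Spaces.linear (*s) (*s) T" "eigenbasis m L T B ev"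
  shows "mset (eigenvalue_list L T) = image_mset ev (mset_set B)"
proof (rule multiset_eqI)
  fix \<mu>
  interpret weighted_inner m by (rule assms(1))
  have fin: "finite B" and B: "0 \<notin> B" "pairwise (\<lambda>e e'. inner_m m e e' = 0) B"
    using assms(3) by (auto simp: eigenbasis_def)
  let ?C = "\<lambda>\<mu>. {e \<in> B. ev e = \<mu>}"
  note es = eigenspace_eq_span[OF assms]
  have "vec.independent B" by (intro orthogonal_independent fin B)
  then have "vec.independent (?C \<mu>)" for \<mu>
    by (rule vec.independent_mono) auto
  then have dim: "vec.dim (eigenspace L T (complex_of_real \<mu>)) = card (?C \<mu>)" for \<mu>
    by (simp add: es vec.dim_span_eq_card_independent del: vec.dim_span)
  have is_ev: "is_eigenvalue L T (complex_of_real \<mu>) \<longleftrightarrow> \<mu> \<in> ev ` B" for \<mu>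
  proof -
    have "is_eigenvalue L T (complex_of_real \<mu>) \<longleftrightarrow> \<not> eigenspace L T (complex_of_real \<mu>) \<subseteq> {0}"
      by (auto simp: is_eigenvalue_def eigenspace_def)
    also have "\<dots> \<longleftrightarrow> card (?C \<mu>) \<noteq> 0"
      by (simp only: vec.dim_eq_0[symmetric] dim)
    also have "\<dots> \<longleftrightarrow> \<mu> \<in> ev ` B" using fin by auto
    finally show ?thesis .
  qed
  have "count (mset (eigenvalue_list L T)) \<mu> = card (?C \<mu>)"
    unfolding eigenvalue_list_def is_ev dim
    by (subst count_concat_replicate) (use fin in \<open>auto simp: image_iff\<close>)
  also have "\<dots> = count (image_mset ev (mset_set B)) \<mu>"
    using fin by (auto simp: count_image_mset vimage_def Int_def conj_commute)
  finally show "count (mset (eigenvalue_list L T)) \<mu> = count (image_mset ev (mset_set B)) \<mu>" .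
qed

lemma nth_eigenvalue_le_iff:
  assumes "weighted_inner m" "Vector_Spaces.linear (*s) (*s) T" "eigenbasis m L T B ev"
    and "1 \<le> k" "k \<le> card B"
  shows "nth_eigenvalue L T k \<le> t \<longleftrightarrow> k \<le> card {e \<in> B. ev e \<le> t}"
proof -
  let ?xs = "eigenvalue_list L T"
  note ms = mset_eigenvalue_list[OF assms(1-3)]
  have fin: "finite B" using assms(3) by (simp add: eigenbasis_def)
  have len: "length ?xs = card B"
    using arg_cong[OF ms, of size] by simp
  have "length (filter (\<lambda>x. x \<le> t) ?xs) = size (filter_mset (\<lambda>x. x \<le> t) (mset ?xs))"
    by (simp flip: size_mset mset_filter)
  also have "\<dots> = card {e \<in> B. ev e \<le> t}"
    using fin by (simp add: ms filter_mset_image_mset filter_mset_mset_set)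
  \<comment> \<open>The bound \<open>k \<le> card B\<close> keeps the index \<open>k - 1\<close>
    inside the list, and \<open>1 \<le> k\<close> turns \<open>k - 1 < n\<close> into
    \<open>k \<le> n\<close>.\<close>
  finally show ?thesis
    unfolding nth_eigenvalue_def
    using sorted_nth_le_iff[OF sorted_eigenvalue_list, of "k - 1" L T t] assms(4,5) len by auto
qed

section \<open>The min-max principle\<close>

text \<open>The form of \<open>T - t\<close> is diagonal in an eigenbasis, and the sign of
  \<open>ev e - t\<close> decides the sign of each summand. Choosing \<open>C\<close> as the vectors
  with value at most \<open>t\<close>, or above \<open>t\<close>, yields the next two
  bounds.\<close>

lemma rayleigh_expansion:
  assumes "Vector_Spaces.linear (*s) (*s) T" "eigenbasis m L T B ev" "C \<subseteq> B"
  shows "Re (inner_m m (T (\<Sum>e\<in>C. c e *s e)) (\<Sum>e\<in>C. c e *s e))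
      - t * Re (inner_m m (\<Sum>e\<in>C. c e *s e) (\<Sum>e\<in>C. c e *s e))
    = (\<Sum>e\<in>C. (ev e - t) * ((cmod (c e))\<^sup>2 * Re (inner_m m e e)))"
proof -
  interpret T: Vector_Spaces.linear "(*s)" "(*s)" T by (rule assms(1))
  have fin: "finite C" and orth: "pairwise (\<lambda>e e'. inner_m m e e' = 0) C"
    using assms(2,3) by (auto simp: eigenbasis_def intro: finite_subset pairwise_subset)
  have T: "T (\<Sum>e\<in>C. c e *s e) = (\<Sum>e\<in>C. (complex_of_real (ev e) * c e) *s e)"
    unfolding T.sum T.scale
    by (rule sum.cong) (use assms(2,3) in \<open>auto simp: eigenbasis_def mult_ac\<close>)
  have "Re (complex_of_real (ev e) * c e * cnj (c e) * inner_m m e e)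
      - t * Re (c e * cnj (c e) * inner_m m e e)
      = (ev e - t) * ((cmod (c e))\<^sup>2 * Re (inner_m m e e))" for e
  proof -
    have cc: "c e * cnj (c e) = complex_of_real ((cmod (c e))\<^sup>2)"
      by (simp add: complex_norm_square del: of_real_power)
    show ?thesis
      unfolding mult.assoc[of _ "c e"] cc by (simp add: algebra_simps)
  qed
  then show ?thesis
    unfolding T inner_m_orthogonal_expansion[OF fin orth]
    by (simp add: sum_distrib_left sum_subtractf[symmetric])
qed

lemma rayleigh_le_on_span:
  assumes "weighted_inner m" "Vector_Spaces.linear (*s) (*s) T" "eigenbasis m L T B ev"
    and "f \<in> vec.span {e \<in> B. ev e \<le> t}"
  shows "Re (inner_m m (T f) f) \<le> t * Re (inner_m m f f)"
proof -
  interpret weighted_inner m by (rule assms(1))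
  let ?C = "{e \<in> B. ev e \<le> t}"
  have "finite ?C" using assms(3) by (simp add: eigenbasis_def)
  then obtain c where c: "f = (\<Sum>e\<in>?C. c e *s e)"
    using assms(4) vec.span_finite by auto
  have "(\<Sum>e\<in>?C. (ev e - t) * ((cmod (c e))\<^sup>2 * Re (inner_m m e e))) \<le> 0"
    by (rule sum_nonpos) (auto intro!: mult_nonpos_nonneg mult_nonneg_nonneg inner_m_self_nonneg)
  then show ?thesis
    using rayleigh_expansion[OF assms(2,3), of ?C c t] by (simp add: c)
qed

lemma rayleigh_gt_on_span:
  assumes "weighted_inner m" "Vector_Spaces.linear (*s) (*s) T" "eigenbasis m L T B ev"
    and "f \<in> vec.span {e \<in> B. t < ev e}" "f \<noteq> 0"
  shows "t * Re (inner_m m f f) < Re (inner_m m (T f) f)"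
proof -
  interpret weighted_inner m by (rule assms(1))
  let ?C = "{e \<in> B. t < ev e}"
  have fin: "finite ?C" using assms(3) by (simp add: eigenbasis_def)
  then obtain c where c: "f = (\<Sum>e\<in>?C. c e *s e)"
    using assms(4) vec.span_finite by auto
  obtain e where e: "e \<in> ?C" "c e \<noteq> 0"
    using \<open>f \<noteq> 0\<close> unfolding c by (metis (no_types, lifting) sum.neutral vec.scale_zero_left)
  have "e \<noteq> 0" using e(1) assms(3) by (auto simp: eigenbasis_def)
  then have "0 < (ev e - t) * ((cmod (c e))\<^sup>2 * Re (inner_m m e e))"
    using e by (auto intro!: mult_pos_pos inner_m_self_pos)
  then have "0 < (\<Sum>e\<in>?C. (ev e - t) * ((cmod (c e))\<^sup>2 * Re (inner_m m e e)))"
    by (intro sum_pos2[OF fin e(1)]) (auto intro!: mult_nonneg_nonneg inner_m_self_nonneg)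
  then show ?thesis
    using rayleigh_expansion[OF assms(2,3), of ?C c t] by (simp add: c)
qed

lemma card_eigenbasis:
  assumes "weighted_inner m" "eigenbasis m L T B ev"
  shows "card B = vec.dim L"
proof -
  interpret weighted_inner m by (rule assms(1))
  have "vec.independent B"
    using assms(2) by (intro orthogonal_independent) (auto simp: eigenbasis_def)
  then show ?thesis
    using assms(2) vec.dim_span_eq_card_independent[of B] by (simp add: eigenbasis_def)
qed

text \<open>The set \<open>C\<close> collects all basis vectors whose value is at most the
  \<open>k\<close>-th eigenvalue. If that eigenvalue is repeated, there may be more than
  \<open>k\<close> of them, hence the inequality for \<open>card C\<close>.\<close>

lemma low_eigenvectors:
  assumes "self_adjoint_operator m L T" "1 \<le> k" "k \<le> vec.dim L"
  obtains C where "C \<subseteq> L" "k \<le> card C" "finite C" "0 \<notin> C"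
    "pairwise (\<lambda>e e'. inner_m m e e' = 0) C"
    "\<And>f. f \<in> vec.span C \<Longrightarrow> Re (inner_m m (T f) f) \<le> nth_eigenvalue L T k * Re (inner_m m f f)"
proof -
  interpret self_adjoint_operator m L T by (rule assms(1))
  obtain B ev where B: "eigenbasis m L T B ev"
    using spectral_theorem[OF assms(1)] .
  let ?t = "nth_eigenvalue L T k"
  let ?C = "{e \<in> B. ev e \<le> ?t}"
  have "B \<subseteq> L" using B vec.span_superset by (auto simp: eigenbasis_def)
  \<comment> \<open>The counting criterion with the \<open>k\<close>-th eigenvalue itself as
    threshold, so that its left side holds trivially.\<close>
  moreover have "k \<le> card ?C"
    using nth_eigenvalue_le_iff[OF weighted_inner_axioms linear B assms(2), of ?t]
      card_eigenbasis[OF weighted_inner_axioms B] assms(3) by simp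
  moreover have "pairwise (\<lambda>e e'. inner_m m e e' = 0) ?C" "finite ?C" "0 \<notin> ?C"
    using B by (auto simp: eigenbasis_def intro: pairwise_subset)
  ultimately show thesis
    using that[of ?C] rayleigh_le_on_span[OF weighted_inner_axioms linear B] by blast
qed

text \<open>The upper half of min-max. The space \<open>F\<close> meets the span of the eigenvectors
  with value above \<open>t\<close> only in 0, since a nonzero common vector would have Rayleigh
  quotient both at most \<open>t\<close> and above \<open>t\<close>. Counting dimensions leaves at
  least \<open>k\<close> basis vectors with value at most \<open>t\<close>.\<close>

lemma nth_eigenvalue_le:
  assumes "self_adjoint_operator m L T" "1 \<le> k"
    and F: "vec.subspace F" "F \<subseteq> L" "k \<le> vec.dim F"
    and le: "\<And>f. f \<in> F \<Longrightarrow> Re (inner_m m (T f) f) \<le> t * Re (inner_m m f f)"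
  shows "nth_eigenvalue L T k \<le> t"
proof -
  interpret self_adjoint_operator m L T by (rule assms(1))
  obtain B ev where B: "eigenbasis m L T B ev"
    using spectral_theorem[OF assms(1)] .
  have fin: "finite B" and span: "vec.span B = L" using B by (auto simp: eigenbasis_def)
  let ?H = "{e \<in> B. t < ev e}"
  have "vec.independent B"
    using B by (intro orthogonal_independent) (auto simp: eigenbasis_def)
  then have "vec.independent ?H" by (rule vec.independent_mono) auto
  then have dimH: "vec.dim (vec.span ?H) = card ?H"
    by (rule vec.dim_span_eq_card_independent)
  have "F \<inter> vec.span ?H \<subseteq> {0}"
  proof
    fix f assume f: "f \<in> F \<inter> vec.span ?H"
    then show "f \<in> {0}"
      using le[of f] rayleigh_gt_on_span[OF weighted_inner_axioms linear B, of f t] by force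
  qed
  then have "vec.dim (F \<inter> vec.span ?H) = 0" by (simp only: vec.dim_eq_0)
  then have "vec.dim F + card ?H = vec.dim {x + y |x y. x \<in> F \<and> y \<in> vec.span ?H}"
    using vec.dim_sums_Int[OF F(1) vec.subspace_span[of ?H]] dimH by linarith
  also have "\<dots> \<le> vec.dim L"
    using F(2) subspace vec.span_mono[of ?H B] span
    by (intro vec.dim_subset) (auto intro!: vec.subspace_add)
  also have "vec.dim L = card B"
    using card_eigenbasis[OF weighted_inner_axioms B] by simp
  also have "\<dots> = card {e \<in> B. ev e \<le> t} + card ?H"
    using fin by (subst card_Un_disjoint[symmetric]) (auto intro!: arg_cong[of _ _ card])
  finally have "k \<le> card {e \<in> B. ev e \<le> t}" using F(3) by simp
  moreover have "k \<le> card B"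
    using F(2,3) vec.dim_subset[of F L] card_eigenbasis[OF weighted_inner_axioms B] by simp
  ultimately show ?thesis
    using nth_eigenvalue_le_iff[OF weighted_inner_axioms linear B assms(2)] by blast
qed

section \<open>The special Laplacian and its Dirichlet restrictions\<close>

lemma linear_special_laplacian: "Vector_Spaces.linear (*s) (*s) (special_laplacian E b m)"
  by unfold_locales
    (simp_all add: special_laplacian_def vec_eq_iff sum_distrib_left sum.distrib[symmetric] algebra_simps)

lemma linear_dirichlet_laplacian:
  "Vector_Spaces.linear (*s) (*s) (dirichlet_laplacian E b m W)"
proof -
  interpret S: Vector_Spaces.linear "(*s)" "(*s)" "special_laplacian E b m"
    by (rule linear_special_laplacian)
  show ?thesis
    by unfold_locales
      (simp_all add: dirichlet_laplacian_def S.add S.scale vec_eq_iff algebra_simps)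
qed

lemma subspace_supported_in: "vec.subspace (supported_in W)"
  by (auto simp: vec.subspace_def supported_in_def)

text \<open>The unit vectors at the points of \<open>W\<close> are independent. The bound ensures
  that the Dirichlet spectrum has a \<open>k\<close>-th entry whenever \<open>k\<close> is from 1 to
  \<open>card W\<close>.\<close>

lemma card_le_dim_supported_in: "card W \<le> vec.dim (supported_in W :: (complex ^ 'v::finite) set)"
proof -
  let ?I = "(\<lambda>x. axis x 1) ` W :: (complex ^ 'v) set"
  have "vec.independent ?I"
    by (rule vec.independent_mono[OF independent_cart_basis]) (auto simp: cart_basis_def)
  moreover have "?I \<subseteq> supported_in W"
    by (auto simp: supported_in_def axis_def)
  ultimately have "card ?I \<le> vec.dim (supported_in W :: (complex ^ 'v) set)"
    by (intro vec.independent_card_le_dim)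
  moreover have "card ?I = card W"
    by (rule card_image) (auto simp: inj_on_def axis_eq_axis)
  ultimately show ?thesis by simp
qed

text \<open>The cut-off outside \<open>W\<close> only alters values that are paired with zeros of
  \<open>f\<close>, so Dirichlet bounds become bounds for the special Laplacian.\<close>

lemma inner_m_dirichlet_laplacian:
  assumes "f \<in> supported_in W"
  shows "inner_m m (dirichlet_laplacian E b m W f) f = inner_m m (special_laplacian E b m f) f"
  unfolding inner_m_def dirichlet_laplacian_def
  by (rule sum.cong) (use assms in \<open>auto simp: supported_in_def\<close>)

text \<open>Being neighbours is symmetric, so a neighbour of a point outside \<open>V\<close> is
  never interior to \<open>V\<close>. At such a point every difference in the Laplacian is therefore
  0 - 0.\<close>

lemma special_laplacian_supported_in:
  assumes "f \<in> supported_in (vertex_interior E V)"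
  shows "special_laplacian E b m f \<in> supported_in V"
proof -
  have "f $ x = f $ y" if "x \<notin> V" "y \<in> nbrs E x" for x y
  proof -
    have "x \<in> nbrs E y" using that(2) by (auto simp: nbrs_def out_nbrs_def in_nbrs_def)
    then have "x \<notin> vertex_interior E V" "y \<notin> vertex_interior E V"
      using that(1) by (auto simp: vertex_interior_def)
    then show ?thesis using assms by (simp add: supported_in_def)
  qed
  then show ?thesis by (simp add: special_laplacian_def supported_in_def)
qed

section \<open>The eigenvalue inequality for two disjoint vertex sets\<close>

context weighted_digraph
begin

lemma self_adjoint_special_laplacian: "self_adjoint_operator m UNIV (special_laplacian E b m)"
  by (intro self_adjoint_operator.intro weighted_inner.intro self_adjoint_operator_axioms.intro)
    (auto intro: m_pos linear_special_laplacian special_laplacian_self_adjoint)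

lemma self_adjoint_dirichlet_laplacian:
  "self_adjoint_operator m (supported_in W) (dirichlet_laplacian E b m W)"
proof (intro self_adjoint_operator.intro weighted_inner.intro self_adjoint_operator_axioms.intro
    m_pos linear_dirichlet_laplacian subspace_supported_in dirichlet_laplacian_self_adjoint)
  show "dirichlet_laplacian E b m W f \<in> supported_in W" for f
    by (simp add: dirichlet_laplacian_def supported_in_def)
qed

lemma lambda_special_add_le_max:
  assumes "V \<inter> V' = {}"
    and "1 \<le> k" "k \<le> card (vertex_interior E V)"
    and "1 \<le> l" "l \<le> card (vertex_interior E V')"
  shows "lambda_special E b m (k + l)
      \<le> max (lambda_dirichlet E b m (vertex_interior E V) k)
            (lambda_dirichlet E b m (vertex_interior E V') l)"
proof -
  interpret weighted_inner m by unfold_locales (rule m_pos)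
  interpret S: Vector_Spaces.linear "(*s)" "(*s)" "special_laplacian E b m"
    by (rule linear_special_laplacian)
  let ?W = "vertex_interior E V" and ?W' = "vertex_interior E V'"
  let ?S = "special_laplacian E b m"
  let ?t = "max (lambda_dirichlet E b m ?W k) (lambda_dirichlet E b m ?W' l)"
  have WV: "supported_in ?W \<subseteq> supported_in V" "supported_in ?W' \<subseteq> supported_in V'"
    by (auto simp: supported_in_def vertex_interior_def)
  have dims: "k \<le> vec.dim (supported_in ?W :: (complex ^ 'v) set)"
    "l \<le> vec.dim (supported_in ?W' :: (complex ^ 'v) set)"
    using assms card_le_dim_supported_in order_trans by blast+
  obtain C where C: "C \<subseteq> supported_in ?W" "k \<le> card C" "finite C" "0 \<notin> C"
      "pairwise (\<lambda>e e'. inner_m m e e' = 0) C"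
      "\<And>f. f \<in> vec.span C \<Longrightarrow> Re (inner_m m (dirichlet_laplacian E b m ?W f) f)
          \<le> lambda_dirichlet E b m ?W k * Re (inner_m m f f)"
    using low_eigenvectors[OF self_adjoint_dirichlet_laplacian assms(2) dims(1)]
    unfolding lambda_dirichlet_def by blast
  obtain C' where C': "C' \<subseteq> supported_in ?W'" "l \<le> card C'" "finite C'" "0 \<notin> C'"
      "pairwise (\<lambda>e e'. inner_m m e e' = 0) C'"
      "\<And>f. f \<in> vec.span C' \<Longrightarrow> Re (inner_m m (dirichlet_laplacian E b m ?W' f) f)
          \<le> lambda_dirichlet E b m ?W' l * Re (inner_m m f f)"
    using low_eigenvectors[OF self_adjoint_dirichlet_laplacian assms(4) dims(2)]
    unfolding lambda_dirichlet_def by blast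
  have orth: "inner_m m f g = 0" "inner_m m g f = 0"
    if "f \<in> supported_in V" "g \<in> supported_in V'" for f g
    using inner_m_disjoint_support[OF that assms(1)] cnj_inner_m[of m f g] by auto
  have CC': "inner_m m f g = 0" "inner_m m g f = 0" if "f \<in> C" "g \<in> C'" for f g
    using orth[of f g] that C(1) C'(1) WV by blast+
  \<comment> \<open>A common vector would be orthogonal to itself, hence 0. Disjointness lets the
    cardinalities of \<open>C\<close> and \<open>C'\<close> add up to at least
    \<open>k + l\<close>.\<close>
  have "C \<inter> C' = {}"
  proof (intro equalityI subsetI)
    fix f assume f: "f \<in> C \<inter> C'"
    then have "inner_m m f f = 0" by (intro CC') auto
    then show "f \<in> {}" using f C(4) inner_m_self_eq_0_iff by auto
  qed simp
  moreover have "pairwise (\<lambda>e e'. inner_m m e e' = 0) (C \<union> C')"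
    using C(5) C'(5) by (auto simp: pairwise_def CC')
  then have "vec.independent (C \<union> C')"
    using C(3,4) C'(3,4) by (intro orthogonal_independent) auto
  ultimately have dim: "k + l \<le> vec.dim (vec.span (C \<union> C'))"
    using C(2,3) C'(2,3) vec.dim_span_eq_card_independent[of "C \<union> C'"]
    by (simp add: card_Un_disjoint)
  have "Re (inner_m m (?S f) f) \<le> ?t * Re (inner_m m f f)" if fC: "f \<in> vec.span (C \<union> C')" for f
  proof -
    obtain g h where f: "f = g + h" and g: "g \<in> vec.span C" and h: "h \<in> vec.span C'"
      using fC by (auto simp: vec.span_Un)
    have gW: "g \<in> supported_in ?W" and hW: "h \<in> supported_in ?W'"
      using g h vec.span_minimal[OF C(1) subspace_supported_in]
        vec.span_minimal[OF C'(1) subspace_supported_in] by auto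
    have SV: "?S g \<in> supported_in V" "?S h \<in> supported_in V'"
      using gW hW by (auto intro: special_laplacian_supported_in)
    have gV: "g \<in> supported_in V" and hV: "h \<in> supported_in V'"
      using gW hW WV by auto
    \<comment> \<open>The mixed terms vanish: \<open>?S g\<close> lives on \<open>V\<close> and
      \<open>h\<close> on \<open>V'\<close>, and likewise with the roles exchanged. It is the
      support in the interiors that keeps \<open>?S g\<close> and \<open>?S h\<close> inside the two
      disjoint sets.\<close>
    have "Re (inner_m m (?S f) f) = Re (inner_m m (?S g) g) + Re (inner_m m (?S h) h)"
      using orth(1)[OF SV(1) hV] orth(2)[OF gV SV(2)]
      by (simp add: f S.add inner_m_add_left inner_m_add_right)
    also have "\<dots> \<le> lambda_dirichlet E b m ?W k * Re (inner_m m g g)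
        + lambda_dirichlet E b m ?W' l * Re (inner_m m h h)"
      using C(6)[OF g] C'(6)[OF h]
      by (simp add: inner_m_dirichlet_laplacian gW hW add_mono)
    \<comment> \<open>Both squared lengths are nonnegative, so each eigenvalue may be raised to the
      maximum; orthogonality of \<open>g\<close> and \<open>h\<close> then recombines the
      lengths.\<close>
    also have "\<dots> \<le> ?t * Re (inner_m m g g) + ?t * Re (inner_m m h h)"
      by (intro add_mono mult_right_mono inner_m_self_nonneg) auto
    also have "\<dots> = ?t * Re (inner_m m f f)"
      using orth[OF gV hV]
      by (simp add: f inner_m_add_left inner_m_add_right distrib_left)
    finally show ?thesis .
  qed
  then have "nth_eigenvalue UNIV ?S (k + l) \<le> ?t"
    using assms(2) dim
    by (intro nth_eigenvalue_le[OF self_adjoint_special_laplacian, where F = "vec.span (C \<union> C')"])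
      (auto intro: vec.subspace_span)
  then show ?thesis by (simp add: lambda_special_def)
qed

end

theorem proposition4p2:
  fixes E :: "('v::finite \<times> 'v) set"
    and b :: "'v \<Rightarrow> 'v \<Rightarrow> real"
    and m :: "'v \<Rightarrow> real"
    and VU VA VB :: "'v set"
    and EU EA EB :: "('v \<times> 'v) set"
    and k l :: nat
  assumes "weighted_digraph E b m"
    and "is_part E VU EU"
    and "is_subgraph E VA EA"
    and "is_subgraph E VB EB"
    and "UNIV = VA \<union> VB"
    and "VA \<inter> VB = {}"
    and "UNIV = vertex_interior E VA \<union> vertex_interior E VB \<union> VU"
    and "vertex_interior E VA \<inter> vertex_interior E VB = {}"
    and "vertex_interior E VA \<inter> VU = {}"
    and "vertex_interior E VB \<inter> VU = {}"
    and "E = EA \<union> EB \<union> EU"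
    and "EA \<inter> EB = {}"
    and "EA \<inter> EU = {}"
    and "EB \<inter> EU = {}"
    and "edge_boundary E VA = EU"
    and "edge_boundary E VB = EU"
    and "1 \<le> k" and "k \<le> min (card (vertex_interior E VA)) (card (vertex_interior E VB))"
    and "1 \<le> l" and "l \<le> min (card (vertex_interior E VA)) (card (vertex_interior E VB))"
  shows "lambda_special E b m (k + l)
      \<le> max (lambda_dirichlet E b m (vertex_interior E VA) k)
            (lambda_dirichlet E b m (vertex_interior E VB) l)"
  using weighted_digraph.lambda_special_add_le_max[OF assms(1,6)] assms(17-20) by simp

end
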